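(* Let $n$ be even. Suppose $\Phi$ is a D&C SPN of depth 3 over $x\in\{0,1\}^n$ whose associated distribution is such that each value of $x$ with $\mathrm{EQUAL}(x)=1$ has an associated probability between $a/2$ and $a$ for some $a>0$, and that the total probability $\delta$ of all of the values of $x$ satisfying $\mathrm{EQUAL}(x)=0$ obeys $\delta\le 1/4$. Then $\Phi$ must have at least $2^{n/2-2}/3$ nodes in its second layer.
   Context: $\mathrm{EQUAL}:\{0,1\}^n\to\{0,1\}$ is defined by $\mathrm{EQUAL}(x)=1$ if $(x_1,\dots,x_{n/2})=(x_{n/2+1},\dots,x_n)$ and $0$ otherwise. Arithmetic circuits: an arithmetic circuit $\Phi$ over a tuple of variables $y$ is a finite directed acyclic graph with a unique node of out-degree $0$ (the root). Each node of in-degree $0$ is labeled by a variable of $y$ or a real constant; every other node is labeled $\times$ (product node) or $+$ (sum node), and edges into sum nodes carry real weights. The children $C(u)$ of $u$ are the nodes with an edge into $u$. Labeled leaves compute their labels, a product node computes $q_u=\prod_{v\in C(u)}q_v$, a sum node computes $q_u=\sum_{v\in C(u)}w_{v,u}q_v$; $q_\Phi$ is the polynomial computed by the root. $\Phi$ is monotone if all weights and constants are non-negative. SPNs: let $x_i\in\{0,1\}$ (with counting measure) and let $f$ be a tuple of non-negative univariate functions $f_{i,j}(x_i)$. A Sum Product Network (SPN) is a monotone arithmetic circuit over $f$; it computes the function $x\mapsto q_\Phi(f(x))$. Its associated distribution on $\{0,1\}^n$ has probabilities $q_\Phi(f(x))/Z$, with $Z=\sum_{x\in\{0,1\}^n}q_\Phi(f(x))$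 (assumed non-zero). The dependency-scope of a node $u$ is the set of those $x_i$ such that some $f_{i,j}$ labels a node in the sub-circuit rooted at $u$. An SPN is decomposable if for every product node the dependency-scopes of its children are pairwise disjoint, complete if for every sum node the dependency-scopes of its children are all equal, and a D&C SPN if it is both. Depth convention: the layer of input (leaf) nodes counts as the first layer. A depth-3 SPN thus consists of a first layer of leaves, a second layer of sum/product nodes whose children are leaves, and a third layer consisting of the root, whose children are second-layer nodes. *)

theory Defs
  imports Complex_Main "HOL-Library.Poly_Mapping" "HOL-Library.FuncSet"
begin

text \<open>
  A polynomial over the variables \<^typ>\<open>'y\<close> is a finitely supported map from monomials to
  coefficients, a monomial being a finitely supported map from variables to exponents.
  Ring operations come from \<^theory>\<open>HOL-Library.Poly_Mapping\<close>.
\<close>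

type_synonym 'y rpoly = "('y \<Rightarrow>\<^sub>0 nat) \<Rightarrow>\<^sub>0 real"

definition pvar :: "'y \<Rightarrow> 'y rpoly" where
  "pvar y = Poly_Mapping.single (Poly_Mapping.single y 1) 1"

definition pconst :: "real \<Rightarrow> 'y rpoly" where
  "pconst c = Poly_Mapping.single 0 c"

definition monom_eval :: "('y \<Rightarrow> real) \<Rightarrow> ('y \<Rightarrow>\<^sub>0 nat) \<Rightarrow> real" where
  "monom_eval \<alpha> m = (\<Prod>y\<in>Poly_Mapping.keys m. \<alpha> y ^ Poly_Mapping.lookup m y)"

definition peval :: "('y \<Rightarrow> real) \<Rightarrow> 'y rpoly \<Rightarrow> real" where
  "peval \<alpha> p = (\<Sum>m\<in>Poly_Mapping.keys p. Poly_Mapping.lookup p m * monom_eval \<alpha> m)"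

lemma monom_eval_superset:
  assumes "finite A" "Poly_Mapping.keys m \<subseteq> A"
  shows "monom_eval \<alpha> m = (\<Prod>y\<in>A. \<alpha> y ^ Poly_Mapping.lookup m y)"
  unfolding monom_eval_def using assms
  by (intro prod.mono_neutral_left) (auto simp: in_keys_iff)

lemma monom_eval_0 [simp]: "monom_eval \<alpha> 0 = 1"
  by (simp add: monom_eval_def)

lemma monom_eval_add: "monom_eval \<alpha> (m + k) = monom_eval \<alpha> m * monom_eval \<alpha> k"
proof -
  let ?A = "Poly_Mapping.keys m \<union> Poly_Mapping.keys k"
  have "Poly_Mapping.keys (m + k) \<subseteq> ?A"
    by (rule keys_add)
  then show ?thesis
    by (simp add: monom_eval_superset[of ?A] lookup_add power_add prod.distrib)
qed

lemma peval_superset: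
  assumes "finite A" "Poly_Mapping.keys p \<subseteq> A"
  shows "peval \<alpha> p = (\<Sum>m\<in>A. Poly_Mapping.lookup p m * monom_eval \<alpha> m)"
  unfolding peval_def using assms
  by (intro sum.mono_neutral_left) (auto simp: in_keys_iff)

lemma peval_single [simp]: "peval \<alpha> (Poly_Mapping.single m c) = c * monom_eval \<alpha> m"
  by (simp add: peval_def)

lemma peval_pvar [simp]: "peval \<alpha> (pvar y) = \<alpha> y"
  by (simp add: pvar_def) (simp add: monom_eval_def)

lemma peval_pconst [simp]: "peval \<alpha> (pconst c) = c"
  by (simp add: pconst_def)

lemma peval_0 [simp]: "peval \<alpha> 0 = 0"
  by (simp add: peval_def)

lemma peval_1 [simp]: "peval \<alpha> 1 = 1"
  by (metis mult_1 peval_single monom_eval_0 single_one)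

lemma peval_add [simp]: "peval \<alpha> (p + q) = peval \<alpha> p + peval \<alpha> q"
proof -
  let ?A = "Poly_Mapping.keys p \<union> Poly_Mapping.keys q"
  have "Poly_Mapping.keys (p + q) \<subseteq> ?A"
    by (rule keys_add)
  then show ?thesis
    by (simp add: peval_superset[of ?A] lookup_add distrib_right sum.distrib)
qed

lemma rpoly_induct [case_names single sum]:
  fixes p :: "'y rpoly"
  assumes single: "\<And>m c. P (Poly_Mapping.single m c)"
    and sum: "\<And>p q. P p \<Longrightarrow> P q \<Longrightarrow> P (p + q)"
  shows "P p"
proof (induction p rule: update_induct)
  case const
  show ?case using single[of 0 0] by simp
next
  case (update p m c)
  have "Poly_Mapping.update m c p = p + Poly_Mapping.single m c"
    using update.hyps
    by (intro poly_mapping_eqI) (auto simp: lookup_update lookup_add lookup_single in_keys_iff when_def)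
  then show ?case using sum[OF update.IH single] by simp
qed

lemma peval_mult [simp]: "peval \<alpha> (p * q) = peval \<alpha> p * peval \<alpha> q"
proof (induction p rule: rpoly_induct)
  case (single m c)
  show ?case
  proof (induction q rule: rpoly_induct)
    case (single k d)
    show ?case by (simp add: mult_single monom_eval_add)
  next
    case (sum f g)
    then show ?case by (simp only: distrib_left peval_add)
  qed
next
  case (sum f g)
  then show ?case by (simp only: distrib_right peval_add)
qed

lemma peval_sum [simp]: "peval \<alpha> (\<Sum>i\<in>I. p i) = (\<Sum>i\<in>I. peval \<alpha> (p i))"
  by (induction I rule: infinite_finite_induct) auto

lemma peval_prod [simp]: "peval \<alpha> (\<Prod>i\<in>I. p i) = (\<Prod>i\<in>I. peval \<alpha> (p i))"
  by (induction I rule: infinite_finite_induct) auto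

datatype 'y gate = VarLeaf 'y | ConstLeaf real | SumGate | ProdGate

text \<open>
  An edge \<open>(v, u)\<close> leads from the child \<open>v\<close> to its parent \<open>u\<close>; \<open>weight \<Phi> v u\<close> is only
  meaningful when \<open>(v, u)\<close> is an edge into a sum node.
\<close>

record ('v, 'y) circuit =
  nodes :: "'v set"
  edges :: "('v \<times> 'v) set"
  gate :: "'v \<Rightarrow> 'y gate"
  weight :: "'v \<Rightarrow> 'v \<Rightarrow> real"

definition children :: "('v, 'y) circuit \<Rightarrow> 'v \<Rightarrow> 'v set" where
  "children \<Phi> u = {v. (v, u) \<in> edges \<Phi>}"

definition leaves :: "('v, 'y) circuit \<Rightarrow> 'v set" where
  "leaves \<Phi> = {u \<in> nodes \<Phi>. children \<Phi> u = {}}"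

definition is_root :: "('v, 'y) circuit \<Rightarrow> 'v \<Rightarrow> bool" where
  "is_root \<Phi> r \<longleftrightarrow> r \<in> nodes \<Phi> \<and> (\<forall>u. (r, u) \<notin> edges \<Phi>)"

definition root :: "('v, 'y) circuit \<Rightarrow> 'v" where
  "root \<Phi> = (THE r. is_root \<Phi> r)"

definition arithmetic_circuit :: "'y set \<Rightarrow> ('v, 'y) circuit \<Rightarrow> bool" where
  "arithmetic_circuit Y \<Phi> \<longleftrightarrow>
     finite (nodes \<Phi>) \<and>
     edges \<Phi> \<subseteq> nodes \<Phi> \<times> nodes \<Phi> \<and>
     acyclic (edges \<Phi>) \<and>
     (\<exists>!r. is_root \<Phi> r) \<and>
     (\<forall>u\<in>leaves \<Phi>. gate \<Phi> u \<in> VarLeaf ` Y \<union> range ConstLeaf) \<and>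
     (\<forall>u\<in>nodes \<Phi> - leaves \<Phi>. gate \<Phi> u \<in> {SumGate, ProdGate})"

definition node_poly :: "('v, 'y) circuit \<Rightarrow> 'v \<Rightarrow> 'y rpoly" where
  "node_poly \<Phi> = wfrec (edges \<Phi>) (\<lambda>q u.
     case gate \<Phi> u of
       VarLeaf y \<Rightarrow> pvar y
     | ConstLeaf c \<Rightarrow> pconst c
     | SumGate \<Rightarrow> (\<Sum>v\<in>children \<Phi> u. pconst (weight \<Phi> v u) * q v)
     | ProdGate \<Rightarrow> (\<Prod>v\<in>children \<Phi> u. q v))"

definition circuit_poly :: "('v, 'y) circuit \<Rightarrow> 'y rpoly" where
  "circuit_poly \<Phi> = node_poly \<Phi> (root \<Phi>)"

definition monotone_circuit :: "('v, 'y) circuit \<Rightarrow> bool" where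
  "monotone_circuit \<Phi> \<longleftrightarrow>
     (\<forall>u\<in>nodes \<Phi>. gate \<Phi> u = SumGate \<longrightarrow> (\<forall>v\<in>children \<Phi> u. 0 \<le> weight \<Phi> v u)) \<and>
     (\<forall>u\<in>nodes \<Phi>. \<forall>c. gate \<Phi> u = ConstLeaf c \<longrightarrow> 0 \<le> c)"

lemma arithmetic_circuit_wf:
  assumes "arithmetic_circuit Y \<Phi>"
  shows "wf (edges \<Phi>)"
proof -
  have "finite (edges \<Phi>)"
    using assms unfolding arithmetic_circuit_def
    by (meson finite_SigmaI finite_subset)
  then show ?thesis
    using assms by (simp add: arithmetic_circuit_def finite_acyclic_wf)
qed

lemma node_poly_rec:
  assumes "arithmetic_circuit Y \<Phi>"
  shows "node_poly \<Phi> u =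
    (case gate \<Phi> u of
       VarLeaf y \<Rightarrow> pvar y
     | ConstLeaf c \<Rightarrow> pconst c
     | SumGate \<Rightarrow> (\<Sum>v\<in>children \<Phi> u. pconst (weight \<Phi> v u) * node_poly \<Phi> v)
     | ProdGate \<Rightarrow> (\<Prod>v\<in>children \<Phi> u. node_poly \<Phi> v))"
  by (subst def_wfrec[OF eq_reflection[OF node_poly_def] arithmetic_circuit_wf[OF assms]])
     (auto simp: cut_def children_def split: gate.split intro!: sum.cong prod.cong)

definition cube :: "nat \<Rightarrow> (nat \<Rightarrow> nat) set" where
  "cube n = {1..n} \<rightarrow>\<^sub>E {0, 1}"

text \<open>
  The variables of the circuit are index pairs: \<open>(i, j)\<close> stands for the \<open>j\<close>-th univariate function
  \<open>f i j\<close> of the input \<open>x i\<close>, and \<open>m i\<close> is the number of functions of \<open>x i\<close>.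
\<close>

definition spn :: "nat \<Rightarrow> (nat \<Rightarrow> nat) \<Rightarrow> (nat \<Rightarrow> nat \<Rightarrow> nat \<Rightarrow> real) \<Rightarrow>
    ('v, nat \<times> nat) circuit \<Rightarrow> bool" where
  "spn n m f \<Phi> \<longleftrightarrow>
     arithmetic_circuit (SIGMA i:{1..n}. {1..m i}) \<Phi> \<and>
     monotone_circuit \<Phi> \<and>
     (\<forall>i\<in>{1..n}. \<forall>j\<in>{1..m i}. \<forall>b\<in>{0, 1}. 0 \<le> f i j b)"

definition spn_value :: "(nat \<Rightarrow> nat \<Rightarrow> nat \<Rightarrow> real) \<Rightarrow> ('v, nat \<times> nat) circuit \<Rightarrow>
    (nat \<Rightarrow> nat) \<Rightarrow> real" where
  "spn_value f \<Phi> x = peval (\<lambda>(i, j). f i j (x i)) (circuit_poly \<Phi>)"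

definition partition_fun :: "nat \<Rightarrow> (nat \<Rightarrow> nat \<Rightarrow> nat \<Rightarrow> real) \<Rightarrow>
    ('v, nat \<times> nat) circuit \<Rightarrow> real" where
  "partition_fun n f \<Phi> = (\<Sum>x\<in>cube n. spn_value f \<Phi> x)"

definition spn_prob :: "nat \<Rightarrow> (nat \<Rightarrow> nat \<Rightarrow> nat \<Rightarrow> real) \<Rightarrow> ('v, nat \<times> nat) circuit \<Rightarrow>
    (nat \<Rightarrow> nat) \<Rightarrow> real" where
  "spn_prob n f \<Phi> x = spn_value f \<Phi> x / partition_fun n f \<Phi>"

definition dep_scope :: "('v, nat \<times> nat) circuit \<Rightarrow> 'v \<Rightarrow> nat set" where
  "dep_scope \<Phi> u = {i. \<exists>j v. (v, u) \<in> (edges \<Phi>)\<^sup>* \<and> gate \<Phi> v = VarLeaf (i, j)}"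

definition decomposable :: "('v, nat \<times> nat) circuit \<Rightarrow> bool" where
  "decomposable \<Phi> \<longleftrightarrow>
     (\<forall>u\<in>nodes \<Phi>. gate \<Phi> u = ProdGate \<longrightarrow>
        (\<forall>v\<in>children \<Phi> u. \<forall>w\<in>children \<Phi> u. v \<noteq> w \<longrightarrow> dep_scope \<Phi> v \<inter> dep_scope \<Phi> w = {}))"

definition complete_circuit :: "('v, nat \<times> nat) circuit \<Rightarrow> bool" where
  "complete_circuit \<Phi> \<longleftrightarrow>
     (\<forall>u\<in>nodes \<Phi>. gate \<Phi> u = SumGate \<longrightarrow>
        (\<forall>v\<in>children \<Phi> u. \<forall>w\<in>children \<Phi> u. dep_scope \<Phi> v = dep_scope \<Phi> w))"

definition dc_spn :: "nat \<Rightarrow> (nat \<Rightarrow> nat) \<Rightarrow> (nat \<Rightarrow> nat \<Rightarrow> nat \<Rightarrow> real) \<Rightarrow>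
    ('v, nat \<times> nat) circuit \<Rightarrow> bool" where
  "dc_spn n m f \<Phi> \<longleftrightarrow> spn n m f \<Phi> \<and> decomposable \<Phi> \<and> complete_circuit \<Phi>"

definition second_layer :: "('v, 'y) circuit \<Rightarrow> 'v set" where
  "second_layer \<Phi> = {u \<in> nodes \<Phi>. children \<Phi> u \<noteq> {} \<and> children \<Phi> u \<subseteq> leaves \<Phi>}"

text \<open>
  The last two conditions put the root strictly above the second layer: it is neither a leaf nor
  a node with leaf children.
\<close>

definition depth_three :: "('v, 'y) circuit \<Rightarrow> bool" where
  "depth_three \<Phi> \<longleftrightarrow>
     nodes \<Phi> = leaves \<Phi> \<union> second_layer \<Phi> \<union> {root \<Phi>} \<and>
     children \<Phi> (root \<Phi>) \<noteq> {} \<and>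
     children \<Phi> (root \<Phi>) \<subseteq> second_layer \<Phi>"

definition EQUAL :: "nat \<Rightarrow> (nat \<Rightarrow> nat) \<Rightarrow> nat" where
  "EQUAL n x = (if \<forall>i\<in>{1..n div 2}. x i = x (n div 2 + i) then 1 else 0)"

end

theory Submission
  imports Defs "HOL-Analysis.Convex"
begin

text \<open>
  Splitting \<open>x\<close> into its two halves \<open>(y, z)\<close>, every node of the second layer, and hence also a
  product root, computes a non-negative function of the form \<open>\<alpha> y * \<beta> z\<close>. So \<open>\<Phi>\<close> is a sum of \<open>k\<close>
  non-negative rank-one matrices, where \<open>k\<close> is at most the number of second-layer nodes, and \<open>EQUAL\<close>
  is the indicator of the diagonal. If the diagonal entries of a rank-one matrix are at most \<open>b\<close>,
  their sum \<open>d\<close> and the sum \<open>t\<close> of all the entries satisfy \<open>d\<^sup>2 \<le> b * t\<close>. Adding up the \<open>k\<close> terms with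
  the Cauchy-Schwarz inequality bounds the square of the diagonal mass \<open>1 - \<delta>\<close> by \<open>k * a\<close>, whereas
  \<open>2 ^ (n div 2) * a / 2 \<le> 1 - \<delta>\<close>. This gives \<open>k \<ge> 3 / 8 * 2 ^ (n div 2)\<close>.
\<close>

section \<open>Diagonals of sums of non-negative rank-one matrices\<close>

text \<open>The AM-GM inequality in disguise: with \<open>s = sqrt (u * w)\<close> one has s \<le> b
  and 2 * s \<le> \<open>u + w\<close>. Comparing squares avoids the root.\<close>

lemma mult_sum_ge_twice_mult:
  fixes u w b :: real
  assumes "0 \<le> u" "0 \<le> w" "0 \<le> b" "u * w \<le> b\<^sup>2"
  shows "2 * (u * w) \<le> b * (u + w)"
proof (rule power2_le_imp_le)
  have "(2 * (u * w))\<^sup>2 = 4 * (u * w) * (u * w)"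
    by (simp add: power2_eq_square)
  also have "\<dots> \<le> 4 * (u * w) * b\<^sup>2"
    using assms by (intro mult_left_mono) auto
  also have "\<dots> \<le> (u + w)\<^sup>2 * b\<^sup>2"
  proof (rule mult_right_mono)
    have "0 \<le> (u - w)\<^sup>2" by simp
    then show "4 * (u * w) \<le> (u + w)\<^sup>2"
      by (simp add: power2_eq_square algebra_simps)
  qed simp
  finally show "(2 * (u * w))\<^sup>2 \<le> (b * (u + w))\<^sup>2"
    by (simp add: power_mult_distrib mult.commute)
qed (use assms in simp)

text \<open>In a rank-one matrix the mirrored entries at \<open>(y, z)\<close> and
  \<open>(z, y)\<close> have the same product as the two diagonal entries at \<open>y\<close> and
  \<open>z\<close>, so that product is at most \<open>b\<^sup>2\<close>, and
  \<open>mult_sum_ge_twice_mult\<close> applies to the mirrored pair. Summed over all pairs, the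
  left side becomes twice the squared trace and the right side \<open>2 * b\<close> times the sum of
  all entries.\<close>

lemma rank_one_diagonal_square_le:
  fixes \<alpha> \<beta> :: "'y \<Rightarrow> real"
  assumes "0 \<le> b" and nonneg: "\<And>y. y \<in> Y \<Longrightarrow> 0 \<le> \<alpha> y" "\<And>y. y \<in> Y \<Longrightarrow> 0 \<le> \<beta> y"
    and diag: "\<And>y. y \<in> Y \<Longrightarrow> \<alpha> y * \<beta> y \<le> b"
  shows "(\<Sum>y\<in>Y. \<alpha> y * \<beta> y)\<^sup>2 \<le> b * (\<Sum>y\<in>Y. \<Sum>z\<in>Y. \<alpha> y * \<beta> z)"
proof -
  have "2 * ((\<alpha> y * \<beta> y) * (\<alpha> z * \<beta> z)) \<le> b * (\<alpha> y * \<beta> z + \<alpha> z * \<beta> y)"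
    if "y \<in> Y" "z \<in> Y" for y z
  proof -
    have eq: "(\<alpha> y * \<beta> z) * (\<alpha> z * \<beta> y) = (\<alpha> y * \<beta> y) * (\<alpha> z * \<beta> z)"
      by simp
    have "(\<alpha> y * \<beta> y) * (\<alpha> z * \<beta> z) \<le> b\<^sup>2"
      unfolding power2_eq_square using that assms by (intro mult_mono) auto
    then show ?thesis
      using that assms unfolding eq[symmetric] by (intro mult_sum_ge_twice_mult) auto
  qed
  then have "(\<Sum>y\<in>Y. \<Sum>z\<in>Y. 2 * ((\<alpha> y * \<beta> y) * (\<alpha> z * \<beta> z)))
      \<le> (\<Sum>y\<in>Y. \<Sum>z\<in>Y. b * (\<alpha> y * \<beta> z + \<alpha> z * \<beta> y))"
    by (intro sum_mono) auto
  also have "(\<Sum>y\<in>Y. \<Sum>z\<in>Y. b * (\<alpha> y * \<beta> z + \<alpha> z * \<beta> y))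
      = b * (\<Sum>y\<in>Y. \<Sum>z\<in>Y. \<alpha> y * \<beta> z) + b * (\<Sum>y\<in>Y. \<Sum>z\<in>Y. \<alpha> z * \<beta> y)"
    by (simp only: sum_distrib_left sum.distrib distrib_left)
  also have "(\<Sum>y\<in>Y. \<Sum>z\<in>Y. \<alpha> z * \<beta> y) = (\<Sum>y\<in>Y. \<Sum>z\<in>Y. \<alpha> y * \<beta> z)"
    by (rule sum.swap)
  also have "(\<Sum>y\<in>Y. \<Sum>z\<in>Y. 2 * ((\<alpha> y * \<beta> y) * (\<alpha> z * \<beta> z))) = 2 * (\<Sum>y\<in>Y. \<alpha> y * \<beta> y)\<^sup>2"
    by (simp only: power2_eq_square sum_product) (simp only: sum_distrib_left)
  finally show ?thesis by simp
qed

lemma nonneg_rank_diagonal_square_le: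
  fixes \<alpha> \<beta> :: "'k \<Rightarrow> 'y \<Rightarrow> real" and M :: "'y \<Rightarrow> 'y \<Rightarrow> real" and b :: real
  assumes "finite K" and "0 \<le> b"
    and nonneg: "\<And>k y. k \<in> K \<Longrightarrow> y \<in> Y \<Longrightarrow> 0 \<le> \<alpha> k y" "\<And>k y. k \<in> K \<Longrightarrow> y \<in> Y \<Longrightarrow> 0 \<le> \<beta> k y"
    and M: "\<And>y z. y \<in> Y \<Longrightarrow> z \<in> Y \<Longrightarrow> M y z = (\<Sum>k\<in>K. \<alpha> k y * \<beta> k z)"
    and diag: "\<And>y. y \<in> Y \<Longrightarrow> M y y \<le> b"
  shows "(\<Sum>y\<in>Y. M y y)\<^sup>2 \<le> card K * b * (\<Sum>y\<in>Y. \<Sum>z\<in>Y. M y z)"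
proof -
  \<comment> \<open>Non-negativity excludes cancellation between the terms, so the diagonal bound on
    \<open>M\<close> passes to each of them.\<close>
  have entry: "\<alpha> k y * \<beta> k y \<le> b" if "k \<in> K" "y \<in> Y" for k y
  proof -
    have "\<alpha> k y * \<beta> k y \<le> (\<Sum>k\<in>K. \<alpha> k y * \<beta> k y)"
      using that assms by (intro member_le_sum) auto
    also have "\<dots> \<le> b" using diag M that by simp
    finally show ?thesis .
  qed
  have "(\<Sum>y\<in>Y. M y y) = (\<Sum>y\<in>Y. \<Sum>k\<in>K. \<alpha> k y * \<beta> k y)"
    using M by simp
  also have "\<dots> = (\<Sum>k\<in>K. \<Sum>y\<in>Y. \<alpha> k y * \<beta> k y)"
    by (rule sum.swap)
  \<comment> \<open>Cauchy-Schwarz against the all-ones vector on \<open>K\<close>; this is where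
    the factor \<open>card K\<close> arises.\<close>
  finally have "(\<Sum>y\<in>Y. M y y)\<^sup>2 \<le> (\<Sum>k\<in>K. (\<Sum>y\<in>Y. \<alpha> k y * \<beta> k y)\<^sup>2) * card K"
    using sum_squared_le_sum_of_squares by simp
  also have "\<dots> \<le> (\<Sum>k\<in>K. b * (\<Sum>y\<in>Y. \<Sum>z\<in>Y. \<alpha> k y * \<beta> k z)) * card K"
    using assms entry by (intro mult_right_mono sum_mono rank_one_diagonal_square_le) auto
  also have "(\<Sum>k\<in>K. b * (\<Sum>y\<in>Y. \<Sum>z\<in>Y. \<alpha> k y * \<beta> k z))
      = b * (\<Sum>k\<in>K. \<Sum>y\<in>Y. \<Sum>z\<in>Y. \<alpha> k y * \<beta> k z)"
    by (rule sum_distrib_left[symmetric])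
  also have "(\<Sum>k\<in>K. \<Sum>y\<in>Y. \<Sum>z\<in>Y. \<alpha> k y * \<beta> k z) = (\<Sum>y\<in>Y. \<Sum>k\<in>K. \<Sum>z\<in>Y. \<alpha> k y * \<beta> k z)"
    by (rule sum.swap)
  also have "\<dots> = (\<Sum>y\<in>Y. \<Sum>z\<in>Y. \<Sum>k\<in>K. \<alpha> k y * \<beta> k z)"
    by (intro sum.cong refl sum.swap)
  also have "\<dots> = (\<Sum>y\<in>Y. \<Sum>z\<in>Y. M y z)"
    using M by simp
  finally show ?thesis by (simp add: algebra_simps)
qed

section \<open>Matrices of non-negative rank at most one and their entrywise products\<close>

definition rank_one :: "'y set \<Rightarrow> 'z set \<Rightarrow> ('y \<Rightarrow> 'z \<Rightarrow> real) \<Rightarrow> bool" where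
  "rank_one Y Z F \<longleftrightarrow> (\<exists>\<alpha> \<beta>. (\<forall>y\<in>Y. 0 \<le> \<alpha> y) \<and> (\<forall>z\<in>Z. 0 \<le> \<beta> z) \<and>
     (\<forall>y\<in>Y. \<forall>z\<in>Z. F y z = \<alpha> y * \<beta> z))"

lemma rank_oneI:
  assumes "\<And>y. y \<in> Y \<Longrightarrow> 0 \<le> \<alpha> y" "\<And>z. z \<in> Z \<Longrightarrow> 0 \<le> \<beta> z"
    and "\<And>y z. y \<in> Y \<Longrightarrow> z \<in> Z \<Longrightarrow> F y z = \<alpha> y * \<beta> z"
  shows "rank_one Y Z F"
  using assms unfolding rank_one_def by blast

lemma rank_one_const: "0 \<le> c \<Longrightarrow> rank_one Y Z (\<lambda>_ _. c)"
  by (rule rank_oneI[of _ "\<lambda>_. c" _ "\<lambda>_. 1"]) auto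

lemma rank_one_mult:
  assumes "rank_one Y Z F" "rank_one Y Z G"
  shows "rank_one Y Z (\<lambda>y z. F y z * G y z)"
proof -
  from assms obtain \<alpha> \<beta> \<alpha>' \<beta>' where
    "\<forall>y\<in>Y. 0 \<le> \<alpha> y" "\<forall>z\<in>Z. 0 \<le> \<beta> z" "\<forall>y\<in>Y. \<forall>z\<in>Z. F y z = \<alpha> y * \<beta> z"
    "\<forall>y\<in>Y. 0 \<le> \<alpha>' y" "\<forall>z\<in>Z. 0 \<le> \<beta>' z" "\<forall>y\<in>Y. \<forall>z\<in>Z. G y z = \<alpha>' y * \<beta>' z"
    unfolding rank_one_def by blast
  then show ?thesis
    by (intro rank_oneI[of _ "\<lambda>y. \<alpha> y * \<alpha>' y" _ "\<lambda>z. \<beta> z * \<beta>' z"]) auto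
qed

lemma rank_one_prod:
  assumes "\<And>i. i \<in> I \<Longrightarrow> rank_one Y Z (F i)"
  shows "rank_one Y Z (\<lambda>y z. \<Prod>i\<in>I. F i y z)"
  using assms
  by (induction I rule: infinite_finite_induct) (auto intro: rank_one_const rank_one_mult)

section \<open>Splitting the cube into halves\<close>

text \<open>Outside \<open>{1..2 * h}\<close> the two branches are \<open>undefined\<close> for points of \<open>cube h\<close>.\<close>

definition glue :: "nat \<Rightarrow> (nat \<Rightarrow> 'a) \<Rightarrow> (nat \<Rightarrow> 'a) \<Rightarrow> nat \<Rightarrow> 'a" where
  "glue h y z i = (if i \<le> h then y i else z (i - h))"

lemma cube_mem: "y \<in> cube h \<Longrightarrow> i \<in> {1..h} \<Longrightarrow> y i \<in> {0, 1}"
  unfolding cube_def by (rule PiE_mem)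

lemma cube_outside: "y \<in> cube h \<Longrightarrow> i \<notin> {1..h} \<Longrightarrow> y i = undefined"
  unfolding cube_def by (rule PiE_arb)

lemma finite_cube [simp]: "finite (cube h)"
  by (simp add: cube_def finite_PiE)

lemma card_cube: "card (cube h) = 2 ^ h"
  by (simp add: cube_def card_PiE numeral_2_eq_2)

lemma cubeI:
  assumes "\<And>i. i \<in> {1..h} \<Longrightarrow> y i \<in> {0, 1}" "\<And>i. i \<notin> {1..h} \<Longrightarrow> y i = undefined"
  shows "y \<in> cube h"
  unfolding cube_def using assms by (intro PiE_I)

lemma glue_in_cube:
  assumes "y \<in> cube h" "z \<in> cube h"
  shows "glue h y z \<in> cube (2 * h)"
proof (rule cubeI)
  fix i assume "i \<in> {1..2 * h}"
  then show "glue h y z i \<in> {0, 1}"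
    using cube_mem[OF assms(1), of i] cube_mem[OF assms(2), of "i - h"]
    by (cases "i \<le> h") (auto simp: glue_def le_diff_conv)
next
  \<comment> \<open>Index 0 falls under the first half and indices above \<open>2 * h\<close> under
    the second; both halves are \<open>undefined\<close> there.\<close>
  fix i assume "i \<notin> {1..2 * h}"
  then show "glue h y z i = undefined"
    using cube_outside[OF assms(1), of i] cube_outside[OF assms(2), of "i - h"]
    by (cases "i \<le> h") (auto simp: glue_def le_diff_conv)
qed

lemma bij_betw_glue: "bij_betw (\<lambda>(y, z). glue h y z) (cube h \<times> cube h) (cube (2 * h))"
\<comment> \<open>The inverse reads off the two halves; \<open>restrict\<close> makes them
  extensional, as membership in \<open>cube h\<close> demands.\<close>
proof (rule bij_betw_byWitness[where
    f' = "\<lambda>x. (restrict x {1..h}, restrict (\<lambda>i. x (h + i)) {1..h})"])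
  show "\<forall>p\<in>cube h \<times> cube h. (\<lambda>x. (restrict x {1..h}, restrict (\<lambda>i. x (h + i)) {1..h}))
      ((\<lambda>(y, z). glue h y z) p) = p"
    by (auto simp: glue_def fun_eq_iff cube_outside)
  show "\<forall>x\<in>cube (2 * h). (\<lambda>(y, z). glue h y z)
      (restrict x {1..h}, restrict (\<lambda>i. x (h + i)) {1..h}) = x"
    by (auto simp: glue_def fun_eq_iff cube_outside)
  show "(\<lambda>(y, z). glue h y z) ` (cube h \<times> cube h) \<subseteq> cube (2 * h)"
    using glue_in_cube by auto
  show "(\<lambda>x. (restrict x {1..h}, restrict (\<lambda>i. x (h + i)) {1..h})) ` cube (2 * h)
      \<subseteq> cube h \<times> cube h"
  proof (rule image_subsetI)
    fix x assume x: "x \<in> cube (2 * h)"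
    have "restrict x {1..h} \<in> cube h"
      using cube_mem[OF x] by (intro cubeI) (auto simp del: insert_iff)
    moreover have "restrict (\<lambda>i. x (h + i)) {1..h} \<in> cube h"
      using cube_mem[OF x] by (intro cubeI) (auto simp del: insert_iff)
    ultimately show "(restrict x {1..h}, restrict (\<lambda>i. x (h + i)) {1..h}) \<in> cube h \<times> cube h"
      by simp
  qed
qed

lemma EQUAL_glue:
  assumes "y \<in> cube h" "z \<in> cube h"
  shows "EQUAL (2 * h) (glue h y z) = (if y = z then 1 else 0)"
proof -
  \<comment> \<open>Points of the cube are extensional, so agreement on \<open>{1..h}\<close> is
    already equality.\<close>
  have "(\<forall>i\<in>{1..h}. y i = z i) \<longleftrightarrow> y = z"
    using assms unfolding cube_def by (metis PiE_ext)
  then show ?thesis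
    by (simp add: EQUAL_def glue_def)
qed

lemma sum_cube_double:
  fixes F :: "(nat \<Rightarrow> nat) \<Rightarrow> real"
  shows "(\<Sum>x\<in>cube (2 * h). F x) = (\<Sum>y\<in>cube h. \<Sum>z\<in>cube h. F (glue h y z))"
proof -
  have "(\<Sum>x\<in>cube (2 * h). F x) = (\<Sum>p\<in>cube h \<times> cube h. F (case p of (y, z) \<Rightarrow> glue h y z))"
    by (rule sum.reindex_bij_betw[OF bij_betw_glue, symmetric])
  then show ?thesis
    by (simp add: sum.cartesian_product split_beta)
qed

text \<open>By \<open>EQUAL_glue\<close> only diagonal pairs survive in the double sum, so the mass
  on the equal inputs becomes the trace that the rank argument bounds.\<close>

lemma sum_EQUAL_one:
  fixes F :: "(nat \<Rightarrow> nat) \<Rightarrow> real"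
  shows "(\<Sum>x\<in>{x \<in> cube (2 * h). EQUAL (2 * h) x = 1}. F x) = (\<Sum>y\<in>cube h. F (glue h y y))"
proof -
  have "(\<Sum>x\<in>{x \<in> cube (2 * h). EQUAL (2 * h) x = 1}. F x)
      = (\<Sum>x\<in>cube (2 * h). if EQUAL (2 * h) x = 1 then F x else 0)"
    by (rule sum.inter_filter) simp
  also have "\<dots> = (\<Sum>y\<in>cube h. \<Sum>z\<in>cube h. if y = z then F (glue h y z) else 0)"
    unfolding sum_cube_double by (intro sum.cong) (auto simp: EQUAL_glue)
  also have "\<dots> = (\<Sum>y\<in>cube h. F (glue h y y))"
    by simp
  finally show ?thesis .
qed

text \<open>A single coordinate lies in one of the two halves; the factor belonging to the other
  half is the constant 1.\<close>

lemma rank_one_univariate: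
  assumes "i \<in> {1..2 * h}" "\<And>b. b \<in> {0, 1} \<Longrightarrow> 0 \<le> g b"
  shows "rank_one (cube h) (cube h) (\<lambda>y z. g (glue h y z i))"
proof (cases "i \<le> h")
  case True
  then show ?thesis
    using assms cube_mem[of _ h i]
    by (intro rank_oneI[of _ "\<lambda>y. g (y i)" _ "\<lambda>_. 1"]) (auto simp: glue_def)
next
  case False
  then have "i - h \<in> {1..h}" using assms(1) by auto
  then show ?thesis
    using assms False cube_mem[of _ h "i - h"]
    by (intro rank_oneI[of _ "\<lambda>_. 1" _ "\<lambda>z. g (z (i - h))"]) (auto simp: glue_def)
qed

section \<open>Circuits of depth three\<close>

lemma is_root_root:
  assumes "arithmetic_circuit Y \<Phi>"
  shows "is_root \<Phi> (root \<Phi>)"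
  using assms unfolding arithmetic_circuit_def root_def by (blast intro: theI')

text \<open>Only the empty path ends in a leaf. So the scope of a variable leaf is a singleton and
  that of a constant leaf is empty, which is what gives completeness its force one layer up.\<close>

lemma dep_scope_leaf:
  assumes "u \<in> leaves \<Phi>"
  shows "dep_scope \<Phi> u = {i. \<exists>j. gate \<Phi> u = VarLeaf (i, j)}"
proof -
  have "(v, u) \<in> (edges \<Phi>)\<^sup>* \<longleftrightarrow> v = u" for v
    using assms by (auto simp: leaves_def children_def elim: rtranclE)
  then show ?thesis by (simp add: dep_scope_def)
qed

definition node_value :: "(nat \<Rightarrow> nat \<Rightarrow> nat \<Rightarrow> real) \<Rightarrow> ('v, nat \<times> nat) circuit \<Rightarrow> 'v \<Rightarrow>
    (nat \<Rightarrow> nat) \<Rightarrow> real" where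
  "node_value f \<Phi> u x = peval (\<lambda>(i, j). f i j (x i)) (node_poly \<Phi> u)"

text \<open>\<open>peval\<close> is a ring homomorphism, so it commutes with the sums and products
  in \<open>node_poly_rec\<close>.\<close>

lemma node_value_rec:
  assumes "arithmetic_circuit Y \<Phi>"
  shows "node_value f \<Phi> u x =
    (case gate \<Phi> u of
       VarLeaf (i, j) \<Rightarrow> f i j (x i)
     | ConstLeaf c \<Rightarrow> c
     | SumGate \<Rightarrow> (\<Sum>v\<in>children \<Phi> u. weight \<Phi> v u * node_value f \<Phi> v x)
     | ProdGate \<Rightarrow> (\<Prod>v\<in>children \<Phi> u. node_value f \<Phi> v x))"
  unfolding node_value_def
  by (subst node_poly_rec[OF assms]) (auto split: gate.split)

lemma leaf_cases:
  assumes "spn n m f \<Phi>" "u \<in> leaves \<Phi>"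
  obtains (var) i j where "gate \<Phi> u = VarLeaf (i, j)" "i \<in> {1..n}" "j \<in> {1..m i}"
  | (const) c where "gate \<Phi> u = ConstLeaf c" "0 \<le> c"
proof -
  have "u \<in> nodes \<Phi>" using assms(2) by (simp add: leaves_def)
  moreover have "gate \<Phi> u \<in> VarLeaf ` (SIGMA i:{1..n}. {1..m i}) \<union> range ConstLeaf"
    using assms by (auto simp: spn_def arithmetic_circuit_def)
  ultimately show thesis
    using assms(1) var const unfolding spn_def monotone_circuit_def by auto
qed

lemma rank_one_leaf:
  assumes "spn (2 * h) m f \<Phi>" "u \<in> leaves \<Phi>"
  shows "rank_one (cube h) (cube h) (\<lambda>y z. node_value f \<Phi> u (glue h y z))"
proof -
  have ac: "arithmetic_circuit (SIGMA i:{1..2 * h}. {1..m i}) \<Phi>"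
    using assms(1) by (simp add: spn_def)
  from assms show ?thesis
  proof (cases rule: leaf_cases)
    case (var i j)
    then have "rank_one (cube h) (cube h) (\<lambda>y z. f i j (glue h y z i))"
      using assms(1) unfolding spn_def by (intro rank_one_univariate) blast+
    then show ?thesis
      using var by (simp add: node_value_rec[OF ac])
  next
    case (const c)
    then show ?thesis by (simp add: node_value_rec[OF ac] rank_one_const)
  qed
qed

text \<open>A product node multiplies rank-one leaves entrywise. Sums of rank-one matrices need not
  have rank one, but completeness forces the leaves below a sum node to depend on one common
  coordinate or to be all constant, so the node itself is univariate or constant.\<close>

lemma rank_one_second_layer:
  assumes dc: "dc_spn (2 * h) m f \<Phi>" and u: "u \<in> second_layer \<Phi>"
  shows "rank_one (cube h) (cube h) (\<lambda>y z. node_value f \<Phi> u (glue h y z))"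
proof -
  have spn: "spn (2 * h) m f \<Phi>" and complete: "complete_circuit \<Phi>"
    using dc by (auto simp: dc_spn_def)
  then have ac: "arithmetic_circuit (SIGMA i:{1..2 * h}. {1..m i}) \<Phi>"
    and mono: "monotone_circuit \<Phi>"
    by (auto simp: spn_def)
  have nodes: "u \<in> nodes \<Phi>" and ch: "children \<Phi> u \<noteq> {}" "children \<Phi> u \<subseteq> leaves \<Phi>"
    using u by (auto simp: second_layer_def)
  then have "gate \<Phi> u \<in> {SumGate, ProdGate}"
    using ac by (auto simp: arithmetic_circuit_def leaves_def)
  then consider "gate \<Phi> u = ProdGate" | "gate \<Phi> u = SumGate" by auto
  then show ?thesis
  proof cases
    case 1
    then have "node_value f \<Phi> u x = (\<Prod>v\<in>children \<Phi> u. node_value f \<Phi> v x)" for x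
      by (simp add: node_value_rec[OF ac, of f u])
    then show ?thesis
      using ch spn by (simp only:) (auto intro!: rank_one_prod rank_one_leaf)
  next
    case 2
    then have val: "node_value f \<Phi> u x = (\<Sum>v\<in>children \<Phi> u. weight \<Phi> v u * node_value f \<Phi> v x)" for x
      by (simp add: node_value_rec[OF ac, of f u])
    have w: "0 \<le> weight \<Phi> v u" if "v \<in> children \<Phi> u" for v
      using mono nodes 2 that by (auto simp: monotone_circuit_def)
    have scope: "dep_scope \<Phi> v = dep_scope \<Phi> v'" if "v \<in> children \<Phi> u" "v' \<in> children \<Phi> u" for v v'
      using complete nodes 2 that unfolding complete_circuit_def by blast
    show ?thesis
    \<comment> \<open>If one child reads \<open>x i\<close>, equality of scopes makes every child
      read it; otherwise all children are constants.\<close>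
    proof (cases "\<exists>v\<in>children \<Phi> u. \<exists>i j. gate \<Phi> v = VarLeaf (i, j)")
      case True
      then obtain v i j where v: "v \<in> children \<Phi> u" "gate \<Phi> v = VarLeaf (i, j)" by blast
      have "\<exists>j'. gate \<Phi> v' = VarLeaf (i, j')" if "v' \<in> children \<Phi> u" for v'
      proof -
        have "i \<in> dep_scope \<Phi> v"
          using v ch(2) dep_scope_leaf[of v \<Phi>] by auto
        then have "i \<in> dep_scope \<Phi> v'"
          using scope[OF v(1) that] by simp
        then show ?thesis
          using that ch(2) dep_scope_leaf[of v' \<Phi>] by auto
      qed
      then obtain J where J: "\<And>v'. v' \<in> children \<Phi> u \<Longrightarrow> gate \<Phi> v' = VarLeaf (i, J v')"
        by metis
      have range: "i \<in> {1..2 * h} \<and> J v' \<in> {1..m i}" if "v' \<in> children \<Phi> u" for v'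
        by (rule leaf_cases[OF spn, of v']) (use J[OF that] that ch(2) in auto)
      \<comment> \<open>The node is a non-negative combination of functions of the single coordinate
        \<open>x i\<close>.\<close>
      have "node_value f \<Phi> u x = (\<Sum>v'\<in>children \<Phi> u. weight \<Phi> v' u * f i (J v') (x i))" for x
        unfolding val by (intro sum.cong) (auto simp: node_value_rec[OF ac] J)
      moreover have "0 \<le> (\<Sum>v'\<in>children \<Phi> u. weight \<Phi> v' u * f i (J v') b)" if "b \<in> {0, 1}" for b
        using that w range spn by (intro sum_nonneg mult_nonneg_nonneg) (auto simp: spn_def)
      ultimately show ?thesis
        using rank_one_univariate[of i h "\<lambda>b. \<Sum>v'\<in>children \<Phi> u. weight \<Phi> v' u * f i (J v') b"]
          range[OF v(1)] by simp
    next
      case False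
      then have "\<exists>c. gate \<Phi> v = ConstLeaf c \<and> 0 \<le> c" if "v \<in> children \<Phi> u" for v
        by (rule_tac leaf_cases[OF spn, of v]) (use that ch(2) in auto)
      then obtain c where c: "\<And>v. v \<in> children \<Phi> u \<Longrightarrow> gate \<Phi> v = ConstLeaf (c v) \<and> 0 \<le> c v"
        by metis
      have "node_value f \<Phi> u x = (\<Sum>v\<in>children \<Phi> u. weight \<Phi> v u * c v)" for x
        unfolding val by (intro sum.cong) (auto simp: node_value_rec[OF ac] c)
      then show ?thesis
        using w c by (auto intro!: rank_one_const sum_nonneg mult_nonneg_nonneg)
    qed
  qed
qed

text \<open>A sum root yields one term per child, a product root a single term. Indexing the terms
  by nodes lets both cases share one form.\<close>

lemma depth_three_nonneg_rank:
  fixes \<Phi> :: "('v, nat \<times> nat) circuit"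
  assumes dc: "dc_spn (2 * h) m f \<Phi>" and depth: "depth_three \<Phi>"
  obtains K :: "'v set" and \<alpha> \<beta> where "finite K" "card K \<le> card (second_layer \<Phi>)"
    "\<And>k y. k \<in> K \<Longrightarrow> y \<in> cube h \<Longrightarrow> 0 \<le> \<alpha> k y" "\<And>k y. k \<in> K \<Longrightarrow> y \<in> cube h \<Longrightarrow> 0 \<le> \<beta> k y"
    "\<And>y z. y \<in> cube h \<Longrightarrow> z \<in> cube h \<Longrightarrow>
      spn_value f \<Phi> (glue h y z) = (\<Sum>k\<in>K. \<alpha> k y * \<beta> k z)"
proof -
  define r where "r = root \<Phi>"
  have ac: "arithmetic_circuit (SIGMA i:{1..2 * h}. {1..m i}) \<Phi>"
    and mono: "monotone_circuit \<Phi>"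
    using dc by (auto simp: dc_spn_def spn_def)
  have r: "r \<in> nodes \<Phi>"
    using is_root_root[OF ac] by (simp add: r_def is_root_def)
  have ch: "children \<Phi> r \<noteq> {}" "children \<Phi> r \<subseteq> second_layer \<Phi>"
    using depth by (auto simp: depth_three_def r_def)
  have fin: "finite (second_layer \<Phi>)"
    using ac by (simp add: second_layer_def arithmetic_circuit_def)
  have "\<exists>K F. finite K \<and> card K \<le> card (second_layer \<Phi>) \<and>
      (\<forall>k\<in>K. rank_one (cube h) (cube h) (F (k :: 'v))) \<and>
      (\<forall>y z. node_value f \<Phi> r (glue h y z) = (\<Sum>k\<in>K. F k y z))"
  proof -
    have "gate \<Phi> r \<in> {SumGate, ProdGate}"
      using ac r ch by (auto simp: arithmetic_circuit_def leaves_def)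
    then consider "gate \<Phi> r = ProdGate" | "gate \<Phi> r = SumGate" by auto
    then show ?thesis
    proof cases
      case 1
      have "rank_one (cube h) (cube h) (\<lambda>y z. \<Prod>v\<in>children \<Phi> r. node_value f \<Phi> v (glue h y z))"
        using ch dc by (auto intro!: rank_one_prod rank_one_second_layer)
      \<comment> \<open>The second layer contains the children of the root, so it has at least one
        node to pay for the single term.\<close>
      moreover have "card {r} \<le> card (second_layer \<Phi>)"
        using ch fin by (auto simp: Suc_le_eq card_gt_0_iff)
      ultimately show ?thesis
        using 1
        by (intro exI[of _ "{r}"]
            exI[of _ "\<lambda>_ y z. \<Prod>v\<in>children \<Phi> r. node_value f \<Phi> v (glue h y z)"])
          (simp add: node_value_rec[OF ac, of f r])
    next
      case 2
      \<comment> \<open>The edge weight is absorbed as a constant rank-one factor.\<close>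
      have "rank_one (cube h) (cube h) (\<lambda>y z. weight \<Phi> v r * node_value f \<Phi> v (glue h y z))"
        if "v \<in> children \<Phi> r" for v
        using that ch dc mono r 2
        by (intro rank_one_mult rank_one_const rank_one_second_layer)
          (auto simp: monotone_circuit_def)
      moreover have "finite (children \<Phi> r)" "card (children \<Phi> r) \<le> card (second_layer \<Phi>)"
        using fin ch by (auto intro: finite_subset card_mono)
      ultimately show ?thesis
        using 2
        by (intro exI[of _ "children \<Phi> r"]
            exI[of _ "\<lambda>v y z. weight \<Phi> v r * node_value f \<Phi> v (glue h y z)"])
          (simp add: node_value_rec[OF ac, of f r])
    qed
  qed
  then obtain K F where K: "finite K" "card K \<le> card (second_layer \<Phi>)"
    and F: "\<forall>k\<in>K. rank_one (cube h) (cube h) (F (k :: 'v))"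
    and sum: "\<And>y z. node_value f \<Phi> r (glue h y z) = (\<Sum>k\<in>K. F k y z)"
    by blast
  from F obtain \<alpha> \<beta> where "\<forall>k\<in>K. (\<forall>y\<in>cube h. 0 \<le> \<alpha> k y) \<and> (\<forall>z\<in>cube h. 0 \<le> \<beta> k z) \<and>
      (\<forall>y\<in>cube h. \<forall>z\<in>cube h. F k y z = \<alpha> k y * \<beta> k z)"
    unfolding rank_one_def by metis
  moreover have "spn_value f \<Phi> x = node_value f \<Phi> r x" for x
    by (simp add: spn_value_def node_value_def circuit_poly_def r_def)
  ultimately show thesis
    using K sum by (intro that[of K \<alpha> \<beta>]) (auto intro!: sum.cong)
qed

section \<open>Comparing the diagonal mass with the number of rank-one terms\<close>

theorem theorem27:
  fixes n :: nat and m :: "nat \<Rightarrow> nat" and f :: "nat \<Rightarrow> nat \<Rightarrow> nat \<Rightarrow> real"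
    and \<Phi> :: "('v, nat \<times> nat) circuit" and a \<delta> :: real
  assumes "even n"
    and "dc_spn n m f \<Phi>"
    and "depth_three \<Phi>"
    and "partition_fun n f \<Phi> \<noteq> 0"
    and "a > 0"
    and "\<And>x. x \<in> cube n \<Longrightarrow> EQUAL n x = 1 \<Longrightarrow> spn_prob n f \<Phi> x \<in> {a / 2..a}"
    and "\<delta> = (\<Sum>x\<in>{x \<in> cube n. EQUAL n x = 0}. spn_prob n f \<Phi> x)"
    and "\<delta> \<le> 1 / 4"
  shows "real (card (second_layer \<Phi>)) \<ge> 2 powr (real n / 2 - 2) / 3"
proof -
  from \<open>even n\<close> obtain h where n: "n = 2 * h" by blast
  define Z where "Z = partition_fun n f \<Phi>"
  define P where "P y z = spn_prob n f \<Phi> (glue h y z)" for y z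
  define D where "D = (\<Sum>y\<in>cube h. P y y)"
  obtain K :: "'v set" and \<alpha> \<beta> where K: "finite K" "card K \<le> card (second_layer \<Phi>)"
    and nonneg: "\<And>k y. k \<in> K \<Longrightarrow> y \<in> cube h \<Longrightarrow> 0 \<le> \<alpha> k y" "\<And>k y. k \<in> K \<Longrightarrow> y \<in> cube h \<Longrightarrow> 0 \<le> \<beta> k y"
    and val: "\<And>y z. y \<in> cube h \<Longrightarrow> z \<in> cube h \<Longrightarrow>
      spn_value f \<Phi> (glue h y z) = (\<Sum>k\<in>K. \<alpha> k y * \<beta> k z)"
    using depth_three_nonneg_rank[OF assms(2)[unfolded n] assms(3)] by blast
  \<comment> \<open>The sign of the partition function follows from the non-negative decomposition;
    positivity then keeps the factors non-negative after normalisation.\<close>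
  have "0 \<le> Z"
    unfolding Z_def partition_fun_def n sum_cube_double
    by (intro sum_nonneg) (simp add: val nonneg sum_nonneg)
  then have "0 < Z" using assms(4) by (simp add: Z_def)

  have "(\<Sum>x\<in>cube n. spn_prob n f \<Phi> x) = 1"
    using assms(4) by (simp add: spn_prob_def partition_fun_def flip: sum_divide_distrib)
  then have total: "(\<Sum>y\<in>cube h. \<Sum>z\<in>cube h. P y z) = 1"
    unfolding P_def n sum_cube_double .
  have "(\<Sum>x\<in>cube n. spn_prob n f \<Phi> x) =
      (\<Sum>x\<in>{x \<in> cube n. EQUAL n x = 1} \<union> {x \<in> cube n. EQUAL n x = 0}. spn_prob n f \<Phi> x)"
    by (intro sum.cong) (auto simp: EQUAL_def)
  also have "\<dots> = (\<Sum>x\<in>{x \<in> cube n. EQUAL n x = 1}. spn_prob n f \<Phi> x) + \<delta>"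
    unfolding assms(7) by (rule sum.union_disjoint) auto
  also have "(\<Sum>x\<in>{x \<in> cube n. EQUAL n x = 1}. spn_prob n f \<Phi> x) = D"
    unfolding D_def P_def n by (rule sum_EQUAL_one)
  \<comment> \<open>\<open>D\<close> equals 1 - \<delta>, since \<open>EQUAL\<close> takes only the
    values 0 and 1.\<close>
  finally have D: "3 / 4 \<le> D"
    using \<open>(\<Sum>x\<in>cube n. spn_prob n f \<Phi> x) = 1\<close> assms(8) by simp

  have diag: "P y y \<in> {a / 2..a}" if "y \<in> cube h" for y
    unfolding P_def using that n by (intro assms(6)) (auto simp: EQUAL_glue glue_in_cube)
  have "D\<^sup>2 \<le> card K * a * (\<Sum>y\<in>cube h. \<Sum>z\<in>cube h. P y z)"
    unfolding D_def
  proof (rule nonneg_rank_diagonal_square_le)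
    fix y z assume "y \<in> cube h" "z \<in> cube h"
    \<comment> \<open>The normalising factor \<open>1 / Z\<close> is moved into the first
      vector.\<close>
    then show "P y z = (\<Sum>k\<in>K. \<alpha> k y / Z * \<beta> k z)"
      by (simp add: P_def spn_prob_def val Z_def sum_divide_distrib)
  qed (use K nonneg \<open>0 < Z\<close> \<open>0 < a\<close> diag in auto)
  then have upper: "D\<^sup>2 \<le> card K * a"
    using total by simp
  \<comment> \<open>Each of the \<open>2 ^ h\<close> diagonal entries is at least
    \<open>a / 2\<close>.\<close>
  have "(\<Sum>y\<in>cube h. a / 2) \<le> D"
    unfolding D_def using diag by (intro sum_mono) auto
  then have "2 ^ h * a \<le> 2 * D"
    by (simp add: card_cube)
  \<comment> \<open>Scaling the upper bound by \<open>2 ^ h\<close> lets the lower bound on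
    \<open>D\<close> eliminate \<open>a\<close>; one factor \<open>D\<close>, positive by D \<ge>
    3/4, then cancels.\<close>
  have "2 ^ h * D\<^sup>2 \<le> 2 ^ h * (card K * a)"
    using upper by simp
  also have "\<dots> = card K * (2 ^ h * a)"
    by simp
  also have "\<dots> \<le> card K * (2 * D)"
    using \<open>2 ^ h * a \<le> 2 * D\<close> by (intro mult_left_mono) auto
  finally have "(2 ^ h * D) * D \<le> (2 * card K) * D"
    by (simp add: power2_eq_square mult_ac)
  then have "2 ^ h * D \<le> 2 * card K"
    using D by (simp only: mult_le_cancel_right)
  moreover have "2 ^ h * (3 / 4) \<le> 2 ^ h * D"
    using D by (intro mult_left_mono) auto
  \<comment> \<open>The claimed bound is thus \<open>2 ^ h / 12\<close>, below the
    \<open>3 / 8 * 2 ^ h\<close> obtained for \<open>card K\<close>.\<close>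
  moreover have "2 powr (real n / 2 - 2) = 2 ^ h / 4"
    by (simp add: n powr_diff powr_realpow)
  moreover have "real (card K) \<le> real (card (second_layer \<Phi>))" "(0 :: real) \<le> 2 ^ h"
    using K(2) by auto
  ultimately show ?thesis
    by linarith
qed

end
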